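(* Let $(M_1,F_1)$ and $(M_2,F_2)$ be two Finslerian manifolds and let $f_k:M_k\to(0,\infty)$, $k\in\{1,2\}$, be smooth functions such that ${}_{f_2}F_1\star_{f_1}F_2$ is a convolution Finslerian metric on $M_1\times M_2$. Then ${}_{f_2}F_1\star_{f_1}F_2$ is Riemannian if and only if $F_1$ as well as $F_2$ are Riemannian metrics.
   Context: A Finslerian metric on a manifold $M$ is a function $F:TM\to[0,\infty)$ that is $C^\infty$ on the slit tangent bundle $\mathring{T}M$, satisfies $F(x,cy)=cF(x,y)$ for all $c>0$, and has Hessian matrix $g_{ij}(x,y)=\frac12\frac{\partial^2F^2}{\partial y^i\partial y^j}(x,y)$ positive-definite at every point of $\mathring{T}M$. For a product $M=M_1\times M_2$ the slit tangent bundle is $\mathring{T}M=\{(x_1,x_2,y_1,y_2)\in TM: y_1\neq 0,\ y_2\neq 0\}$; on each factor $\mathring{T}M_k$ is $TM_k$ without the zero section. A Finslerian metric $F$ is Riemannian if it has the form $F(x,y)=\sqrt{g_{ij}(x)y^iy^j}$ where $\{g_x\}_{x\in M}$ is a family of inner products on the tangent spaces $T_xM$ with components $g_{ij}(x)$ that are $C^\infty$ in local coordinates; then $\frac12\frac{\partial^2F^2}{\partial y^i\partial y^j}=g_{ij}(x)$ is independent of $y$. Gradient: for a smooth function $u$ on a Finslerian manifold with Hessian matrix $g$, $\nabla u=g^{ij}(x,y)\frac{\partial u}{\partial x^i}\frac{\partial}{\partial x^j}$. Convolution: let $\dim M_1=n_1$, $\dim M_2=n_2$, $n=n_1+n_2$.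 The Finslerian convolution of $F_1$ and $F_2$ via $f_1,f_2$ is $F={}_{f_2}F_1\star_{f_1}F_2:T(M_1\times M_2)\to(0,\infty)$ given by $$F^2=f_2^2F_1^2+f_1^2F_2^2+\tfrac12 f_1f_2\,\frac{\partial F_1^2}{\partial y^i}\frac{\partial F_2^2}{\partial y^j}(\nabla f_1)^i(\nabla f_2)^j,$$ where $F_k,f_k$ are pulled back to $M_1\times M_2$ by the projections, $\nabla f_k$ is the gradient with respect to $F_k$, and repeated indices are summed. Associated matrix: in local coordinates $(x_1^1,\dots,x_1^{n_1},x_2^{n_1+1},\dots,x_2^n)$ the matrix associated with $F$ is $$\begin{pmatrix} f_2^2\,(g_{1\alpha\beta}) & 2f_1f_2\left(\frac{\partial f_1}{\partial x_1^\alpha}\frac{\partial f_2}{\partial x_2^\nu}\right)\\ (0) & f_1^2\,(g_{2\mu\nu})\end{pmatrix},\qquad \alpha,\beta\in\{1,\dots,n_1\},\ \mu,\nu\in\{n_1+1,\dots,n\},$$ where $g_1,g_2$ are the Hessian matrices of $F_1,F_2$. ${}_{f_2}F_1\star_{f_1}F_2$ is called a convolution Finslerian metric when this matrix is positive-definite and symmetric on $\mathring{T}(M_1\times M_2)$ (so that it defines a Finslerian metric on $M_1\times M_2$). *)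

theory Defs
  imports "HOL-Analysis.Analysis"
begin

section \<open>\<open>C\<^sup>\<infinity>\<close> maps on open subsets of Euclidean space\<close>

primrec Ck_on ::
  "nat \<Rightarrow> 'a::euclidean_space set \<Rightarrow> ('a \<Rightarrow> 'b::real_normed_vector) \<Rightarrow> bool"
where
  "Ck_on 0 S f \<longleftrightarrow> continuous_on S f"
| "Ck_on (Suc k) S f \<longleftrightarrow>
     (\<forall>x\<in>S. f differentiable (at x)) \<and>
     (\<forall>v. Ck_on k S (\<lambda>x. frechet_derivative f (at x) v))"

definition smooth_on ::
  "'a::euclidean_space set \<Rightarrow> ('a \<Rightarrow> 'b::real_normed_vector) \<Rightarrow> bool"
  where "smooth_on S f \<longleftrightarrow> (\<forall>k. Ck_on k S f)"

definition partial_deriv :: "(real^'n \<Rightarrow> real) \<Rightarrow> 'n::finite \<Rightarrow> real^'n \<Rightarrow> real"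
  where "partial_deriv f i x = frechet_derivative f (at x) (axis i 1)"


section \<open>Smooth manifolds\<close>

text \<open>
  The underlying space of a manifold is a Hausdorff, second countable type; the smooth structure
  is given by an atlas, not required to be maximal. A chart is a pair of its domain and its
  coordinate map; the values of the coordinate map outside the domain are irrelevant.
\<close>

type_synonym ('a, 'n) chart = "'a set \<times> ('a \<Rightarrow> real^'n)"

abbreviation cdom :: "('a, 'n) chart \<Rightarrow> 'a set"
  where "cdom c \<equiv> fst c"

abbreviation coord :: "('a, 'n) chart \<Rightarrow> 'a \<Rightarrow> real^'n"
  where "coord c \<equiv> snd c"

definition coord_inv :: "('a, 'n) chart \<Rightarrow> real^'n \<Rightarrow> 'a"
  where "coord_inv c = inv_into (cdom c) (coord c)"

definition charts_at :: "('a, 'n) chart set \<Rightarrow> 'a \<Rightarrow> ('a, 'n) chart set"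
  where "charts_at A p = {c \<in> A. p \<in> cdom c}"

definition some_chart :: "('a, 'n) chart set \<Rightarrow> 'a \<Rightarrow> ('a, 'n) chart"
  where "some_chart A p = (SOME c. c \<in> charts_at A p)"

definition smooth_atlas ::
  "('a::{t2_space, second_countable_topology}, 'n::finite) chart set \<Rightarrow> bool"
  where "smooth_atlas A \<longleftrightarrow>
    (\<forall>c\<in>A. open (cdom c) \<and> open (coord c ` cdom c) \<and>
        homeomorphism (cdom c) (coord c ` cdom c) (coord c) (coord_inv c)) \<and>
    (\<Union>c\<in>A. cdom c) = UNIV \<and>
    (\<forall>c\<in>A. \<forall>d\<in>A. smooth_on (coord c ` (cdom c \<inter> cdom d)) (coord d \<circ> coord_inv c))"

definition smooth_fun :: "('a, 'n::finite) chart set \<Rightarrow> ('a \<Rightarrow> real) \<Rightarrow> bool"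
  where "smooth_fun A f \<longleftrightarrow> (\<forall>c\<in>A. smooth_on (coord c ` cdom c) (f \<circ> coord_inv c))"

text \<open>
  A tangent vector at \<open>p\<close> assigns to every chart around \<open>p\<close> its components in that chart, subject to
  the usual transformation law; it is extended by \<open>0\<close> to all other charts.
  The vector operations are pointwise.
\<close>

type_synonym ('a, 'n) tangent = "('a, 'n) chart \<Rightarrow> real^'n"

definition tangent_space ::
  "('a, 'n::finite) chart set \<Rightarrow> 'a \<Rightarrow> ('a, 'n) tangent set"
  where "tangent_space A p = {v.
    (\<forall>c\<in>charts_at A p. \<forall>d\<in>charts_at A p.
        v d = frechet_derivative (coord d \<circ> coord_inv c) (at (coord c p)) (v c)) \<and>
    (\<forall>c. c \<notin> charts_at A p \<longrightarrow> v c = 0)}"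

text \<open>The tangent vector at \<open>p\<close> whose component vector in the chart \<open>c\<close> is \<open>y\<close>.\<close>

definition tangent_of ::
  "('a, 'n::finite) chart set \<Rightarrow> ('a, 'n) chart \<Rightarrow> 'a \<Rightarrow> real^'n \<Rightarrow> ('a, 'n) tangent"
  where "tangent_of A c p y = (\<lambda>d.
    if d \<in> charts_at A p
    then frechet_derivative (coord d \<circ> coord_inv c) (at (coord c p)) y else 0)"

text \<open>
  The differential at \<open>p\<close> of a smooth map \<open>h\<close> between manifolds with atlases \<open>A\<close> and \<open>B\<close>. By the chain
  rule its value on \<open>tangent_space A p\<close> does not depend on the chart chosen around \<open>p\<close>.
\<close>

definition differential ::
  "('a, 'n::finite) chart set \<Rightarrow> ('b, 'm::finite) chart set \<Rightarrow> ('a \<Rightarrow> 'b) \<Rightarrow> 'a \<Rightarrow>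
   ('a, 'n) tangent \<Rightarrow> ('b, 'm) tangent"
  where "differential A B h p v = (\<lambda>d.
    if d \<in> charts_at B (h p)
    then let c = some_chart A p in
      frechet_derivative (coord d \<circ> h \<circ> coord_inv c) (at (coord c p)) (v c)
    else 0)"

definition product_chart ::
  "('a, 'n::finite) chart \<Rightarrow> ('b, 'm::finite) chart \<Rightarrow> ('a \<times> 'b, 'n + 'm) chart"
  where "product_chart c1 c2 =
    (cdom c1 \<times> cdom c2,
     \<lambda>(p, q). \<chi> i. case i of Inl a \<Rightarrow> coord c1 p $ a | Inr b \<Rightarrow> coord c2 q $ b)"

definition product_atlas ::
  "('a, 'n::finite) chart set \<Rightarrow> ('b, 'm::finite) chart set \<Rightarrow> ('a \<times> 'b, 'n + 'm) chart set"
  where "product_atlas A B = {product_chart c1 c2 | c1 c2. c1 \<in> A \<and> c2 \<in> B}"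


section \<open>Finslerian and Riemannian metrics\<close>

text \<open>
  A function on the tangent bundle takes a point and a tangent vector at that point; only its values
  on actual tangent vectors matter.
\<close>

definition in_coords ::
  "('a, 'n::finite) chart set \<Rightarrow> ('a \<Rightarrow> ('a, 'n) tangent \<Rightarrow> real) \<Rightarrow> ('a, 'n) chart \<Rightarrow>
   real^'n \<Rightarrow> real^'n \<Rightarrow> real"
  where "in_coords A F c x y = F (coord_inv c x) (tangent_of A c (coord_inv c x) y)"

definition hessian ::
  "('a, 'n::finite) chart set \<Rightarrow> ('a \<Rightarrow> ('a, 'n) tangent \<Rightarrow> real) \<Rightarrow> ('a, 'n) chart \<Rightarrow>
   real^'n \<Rightarrow> real^'n \<Rightarrow> real^'n^'n"
  where "hessian A F c x y =
    (\<chi> i j. 1/2 * partial_deriv (partial_deriv (\<lambda>y. (in_coords A F c x y)\<^sup>2) j) i y)"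

definition positive_definite :: "real^'n::finite^'n \<Rightarrow> bool"
  where "positive_definite G \<longleftrightarrow> (\<forall>x. x \<noteq> 0 \<longrightarrow> x \<bullet> (G *v x) > 0)"

definition finsler_metric ::
  "('a, 'n::finite) chart set \<Rightarrow> ('a \<Rightarrow> ('a, 'n) tangent \<Rightarrow> real) \<Rightarrow> bool"
  where "finsler_metric A F \<longleftrightarrow>
    (\<forall>p. \<forall>v\<in>tangent_space A p. F p v \<ge> 0) \<and>
    (\<forall>c\<in>A. smooth_on ((coord c ` cdom c) \<times> (UNIV - {0})) (\<lambda>(x, y). in_coords A F c x y)) \<and>
    (\<forall>p. \<forall>v\<in>tangent_space A p. \<forall>r>0. F p (\<lambda>c. r *\<^sub>R v c) = r * F p v) \<and>
    (\<forall>c\<in>A. \<forall>x\<in>coord c ` cdom c. \<forall>y. y \<noteq> 0 \<longrightarrow> positive_definite (hessian A F c x y))"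

definition inner_product_on ::
  "('a, 'n::finite) tangent set \<Rightarrow> (('a, 'n) tangent \<Rightarrow> ('a, 'n) tangent \<Rightarrow> real) \<Rightarrow> bool"
  where "inner_product_on V g \<longleftrightarrow>
    (\<forall>u\<in>V. \<forall>v\<in>V. g u v = g v u) \<and>
    (\<forall>u\<in>V. \<forall>v\<in>V. \<forall>w\<in>V. g (\<lambda>c. u c + v c) w = g u w + g v w) \<and>
    (\<forall>u\<in>V. \<forall>w\<in>V. \<forall>r. g (\<lambda>c. r *\<^sub>R u c) w = r * g u w) \<and>
    (\<forall>u\<in>V. u \<noteq> (\<lambda>_. 0) \<longrightarrow> g u u > 0)"

definition metric_component ::
  "('a, 'n::finite) chart set \<Rightarrow> ('a \<Rightarrow> ('a, 'n) tangent \<Rightarrow> ('a, 'n) tangent \<Rightarrow> real) \<Rightarrow>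
   ('a, 'n) chart \<Rightarrow> 'n \<Rightarrow> 'n \<Rightarrow> real^'n \<Rightarrow> real"
  where "metric_component A g c i j x =
    (let p = coord_inv c x in g p (tangent_of A c p (axis i 1)) (tangent_of A c p (axis j 1)))"

definition riemannian ::
  "('a, 'n::finite) chart set \<Rightarrow> ('a \<Rightarrow> ('a, 'n) tangent \<Rightarrow> real) \<Rightarrow> bool"
  where "riemannian A F \<longleftrightarrow> (\<exists>g.
    (\<forall>p. inner_product_on (tangent_space A p) (g p)) \<and>
    (\<forall>c\<in>A. \<forall>i j. smooth_on (coord c ` cdom c) (metric_component A g c i j)) \<and>
    (\<forall>p. \<forall>v\<in>tangent_space A p. F p v = sqrt (g p v v)))"


section \<open>Convolution\<close>

definition partial_fun :: "('a, 'n::finite) chart \<Rightarrow> ('a \<Rightarrow> real) \<Rightarrow> 'n \<Rightarrow> 'a \<Rightarrow> real"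
  where "partial_fun c u i p = partial_deriv (u \<circ> coord_inv c) i (coord c p)"

text \<open>Components, in the chart \<open>c\<close>, of the gradient of \<open>u\<close> with respect to \<open>F\<close> at \<open>v\<close>.\<close>

definition gradient ::
  "('a, 'n::finite) chart set \<Rightarrow> ('a \<Rightarrow> ('a, 'n) tangent \<Rightarrow> real) \<Rightarrow> ('a \<Rightarrow> real) \<Rightarrow>
   ('a, 'n) chart \<Rightarrow> 'a \<Rightarrow> ('a, 'n) tangent \<Rightarrow> real^'n"
  where "gradient A F u c p v =
    (\<chi> j. \<Sum>i\<in>UNIV. matrix_inv (hessian A F c (coord c p) (v c)) $ i $ j * partial_fun c u i p)"

text \<open>\<open>\<partial>F\<^sup>2/\<partial>y\<^sup>i\<close> at the tangent vector \<open>v\<close>, in the chart \<open>c\<close>.\<close>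

definition fibre_partial ::
  "('a, 'n::finite) chart set \<Rightarrow> ('a \<Rightarrow> ('a, 'n) tangent \<Rightarrow> real) \<Rightarrow>
   ('a, 'n) chart \<Rightarrow> 'n \<Rightarrow> 'a \<Rightarrow> ('a, 'n) tangent \<Rightarrow> real"
  where "fibre_partial A F c i p v =
    partial_deriv (\<lambda>y. (in_coords A F c (coord c p) y)\<^sup>2) i (v c)"

text \<open>
  \<open>F\<^sub>1\<close> and \<open>F\<^sub>2\<close> are pulled back along the differentials of the two projections. The double sum is
  invariant under coordinate changes, so evaluating it in arbitrarily chosen charts is harmless.
  The Hessian has no meaning at zero tangent vectors, but there \<open>\<partial>F\<^sub>k\<^sup>2/\<partial>y\<close> vanishes, so that the
  double sum is \<open>0\<close> whenever one of the two vectors is.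
\<close>

definition convolution ::
  "('a, 'n::finite) chart set \<Rightarrow> ('a \<Rightarrow> ('a, 'n) tangent \<Rightarrow> real) \<Rightarrow> ('a \<Rightarrow> real) \<Rightarrow>
   ('b, 'm::finite) chart set \<Rightarrow> ('b \<Rightarrow> ('b, 'm) tangent \<Rightarrow> real) \<Rightarrow> ('b \<Rightarrow> real) \<Rightarrow>
   'a \<times> 'b \<Rightarrow> ('a \<times> 'b, 'n + 'm) tangent \<Rightarrow> real"
  where "convolution A1 F1 f1 A2 F2 f2 x v =
    (let x1 = fst x; v1 = differential (product_atlas A1 A2) A1 fst x v; c1 = some_chart A1 x1;
         x2 = snd x; v2 = differential (product_atlas A1 A2) A2 snd x v; c2 = some_chart A2 x2
     in sqrt ((f2 x2)\<^sup>2 * (F1 x1 v1)\<^sup>2 + (f1 x1)\<^sup>2 * (F2 x2 v2)\<^sup>2 +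
          1/2 * f1 x1 * f2 x2 *
          (\<Sum>i\<in>UNIV. \<Sum>j\<in>UNIV.
             fibre_partial A1 F1 c1 i x1 v1 * fibre_partial A2 F2 c2 j x2 v2 *
             gradient A1 F1 f1 c1 x1 v1 $ i * gradient A2 F2 f2 c2 x2 v2 $ j)))"

definition associated_matrix ::
  "('a, 'n::finite) chart set \<Rightarrow> ('a \<Rightarrow> ('a, 'n) tangent \<Rightarrow> real) \<Rightarrow> ('a \<Rightarrow> real) \<Rightarrow>
   ('b, 'm::finite) chart set \<Rightarrow> ('b \<Rightarrow> ('b, 'm) tangent \<Rightarrow> real) \<Rightarrow> ('b \<Rightarrow> real) \<Rightarrow>
   ('a, 'n) chart \<Rightarrow> ('b, 'm) chart \<Rightarrow> 'a \<Rightarrow> 'b \<Rightarrow> real^'n \<Rightarrow> real^'m \<Rightarrow>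
   real^('n + 'm)^('n + 'm)"
  where "associated_matrix A1 F1 f1 A2 F2 f2 c1 c2 x1 x2 y1 y2 =
    (\<chi> r s. case (r, s) of
        (Inl \<alpha>, Inl \<beta>) \<Rightarrow> (f2 x2)\<^sup>2 * hessian A1 F1 c1 (coord c1 x1) y1 $ \<alpha> $ \<beta>
      | (Inl \<alpha>, Inr \<nu>) \<Rightarrow> 2 * f1 x1 * f2 x2 * (partial_fun c1 f1 \<alpha> x1 * partial_fun c2 f2 \<nu> x2)
      | (Inr \<mu>, Inl \<beta>) \<Rightarrow> 0
      | (Inr \<mu>, Inr \<nu>) \<Rightarrow> (f1 x1)\<^sup>2 * hessian A2 F2 c2 (coord c2 x2) y2 $ \<mu> $ \<nu>)"

text \<open>
  The slit tangent bundle of the product consists of the vectors both of whose components are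
  nonzero.
\<close>

definition convolution_finsler ::
  "('a, 'n::finite) chart set \<Rightarrow> ('a \<Rightarrow> ('a, 'n) tangent \<Rightarrow> real) \<Rightarrow> ('a \<Rightarrow> real) \<Rightarrow>
   ('b, 'm::finite) chart set \<Rightarrow> ('b \<Rightarrow> ('b, 'm) tangent \<Rightarrow> real) \<Rightarrow> ('b \<Rightarrow> real) \<Rightarrow> bool"
  where "convolution_finsler A1 F1 f1 A2 F2 f2 \<longleftrightarrow>
    (\<forall>x1 x2. \<forall>c1\<in>charts_at A1 x1. \<forall>c2\<in>charts_at A2 x2. \<forall>y1 y2. y1 \<noteq> 0 \<longrightarrow> y2 \<noteq> 0 \<longrightarrow>
      (let G = associated_matrix A1 F1 f1 A2 F2 f2 c1 c2 x1 x2 y1 y2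
       in positive_definite G \<and> transpose G = G))"

end

theory Submission
  imports Defs
begin

text \<open>
  The associated matrix is block triangular, so requiring it to be symmetric forces the off-diagonal
  block to vanish: \<open>\<partial>\<^sub>\<alpha> f\<^sub>1 \<cdot> \<partial>\<^sub>\<nu> f\<^sub>2 = 0\<close> everywhere. Every summand of the cross term of the
  convolution contains a component of each gradient, hence a combination of these products, and
  the convolution collapses to the doubly warped product
  \<open>F\<^sup>2 = f\<^sub>2\<^sup>2 F\<^sub>1\<^sup>2 + f\<^sub>1\<^sup>2 F\<^sub>2\<^sup>2\<close> (\<open>convolution_eq\<close>).

  If \<open>F\<^sub>1\<close> and \<open>F\<^sub>2\<close> come from Riemannian metrics \<open>g\<^sub>1\<close> and \<open>g\<^sub>2\<close>, then \<open>F\<close> comes from the sum of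
  the pullbacks of \<open>g\<^sub>1\<close> and \<open>g\<^sub>2\<close> along the projections, weighted by \<open>f\<^sub>2\<^sup>2\<close> and \<open>f\<^sub>1\<^sup>2\<close>. It is
  definite because a vector killed by both projections is zero (\<open>product_tangent_eq_zero\<close>).
  Conversely, along a slice \<open>p \<mapsto> (p, q)\<close> the second component of a tangent vector is zero, and \<open>F\<close>
  restricts to the constant multiple \<open>f\<^sub>2 q \<cdot> F\<^sub>1\<close>; restricting and rescaling the Riemannian metric of
  \<open>F\<close> shows that \<open>F\<^sub>1\<close> is Riemannian (\<open>riemannian_restrict\<close>, \<open>riemannian_scale\<close>), and likewise for
  \<open>F\<^sub>2\<close>.

  Both directions pull metrics back along projections or slice inclusions. These are affine in
  suitable charts, so smoothness of the pulled back components reduces to an elementary calculus of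
  \<open>C\<^sup>k\<close> functions (\<open>smooth_pullback\<close>); their differentials are handled by the chain rule
  (\<open>differential_comp\<close>).
\<close>


section \<open>Calculus of smooth functions\<close>

lemma Ck_on_cong:
  assumes "open S" "\<And>x. x \<in> S \<Longrightarrow> f x = g x" "Ck_on k S f"
  shows "Ck_on k S g"
  using assms(2,3)
proof (induction k arbitrary: f g)
  case 0
  then show ?case using continuous_on_cong[of S S f g] by simp
next
  case (Suc k)
  have df: "f differentiable at x" if "x \<in> S" for x using Suc.prems(2) that by simp
  have dg: "g differentiable at x" if "x \<in> S" for x
    using df[OF that] has_derivative_transform_within_open[where f = f and g = g, OF _ assms(1) that Suc.prems(1)]
    unfolding differentiable_def by blast
  have eq: "frechet_derivative f (at x) = frechet_derivative g (at x)" if "x \<in> S" for x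
    by (rule frechet_derivative_transform_within_open[OF df[OF that] assms(1) that Suc.prems(1)])
  have "Ck_on k S (\<lambda>x. frechet_derivative g (at x) v)" for v
    by (rule Suc.IH[of "\<lambda>x. frechet_derivative f (at x) v"]) (use eq Suc.prems(2) in auto)
  then show ?case using dg by simp
qed

lemma Ck_on_Suc_imp: "Ck_on (Suc k) S f \<Longrightarrow> Ck_on k S f"
proof (induction k arbitrary: f)
  case 0
  then show ?case
    by (auto intro!: continuous_at_imp_continuous_on differentiable_imp_continuous_within)
next
  case (Suc k)
  then show ?case by (metis Ck_on.simps(2))
qed

lemma Ck_on_has_derivative:
  assumes "Ck_on (Suc k) S f" "x \<in> S"
  shows "(f has_derivative frechet_derivative f (at x)) (at x)"
  using assms frechet_derivative_works by auto

text \<open>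
  On an open set any family of derivatives agrees with the Frechet derivative, so the
  recursive clause may be checked on an explicit formula for the derivative.
\<close>

lemma Ck_on_SucI:
  assumes "open S" "\<And>x. x \<in> S \<Longrightarrow> (f has_derivative f' x) (at x)" "\<And>v. Ck_on k S (\<lambda>x. f' x v)"
  shows "Ck_on (Suc k) S f"
proof -
  have eq: "frechet_derivative f (at x) = f' x" if "x \<in> S" for x
    using frechet_derivative_at[OF assms(2)[OF that]] by simp
  have "Ck_on k S (\<lambda>x. frechet_derivative f (at x) v)" for v
    by (rule Ck_on_cong[OF assms(1) _ assms(3)[of v]]) (simp add: eq)
  then show ?thesis using assms(2) by (auto simp: differentiable_def)
qed

lemma Ck_on_const: "open S \<Longrightarrow> Ck_on k S (\<lambda>x. c)"
proof (induction k arbitrary: c)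
  case (Suc k)
  show ?case by (rule Ck_on_SucI[where f' = "\<lambda>x v. 0"]) (use Suc in auto)
qed simp

lemma Ck_on_add:
  assumes "open S" "Ck_on k S f" "Ck_on k S g"
  shows "Ck_on k S (\<lambda>x. f x + g x)"
  using assms(2,3)
proof (induction k arbitrary: f g)
  case 0
  then show ?case by (auto intro: continuous_on_add)
next
  case (Suc k)
  note D = Ck_on_has_derivative[OF Suc.prems(1)] Ck_on_has_derivative[OF Suc.prems(2)]
  show ?case
    by (rule Ck_on_SucI[OF assms(1) has_derivative_add[OF D]])
       (use Suc in auto)
qed

text \<open>
  By the product rule the derivative at order \<open>Suc k\<close> still contains \<open>f\<close> and \<open>g\<close>
  themselves, which is why the induction needs that \<open>C\<^sup>k\<^sup>+\<^sup>1\<close> implies \<open>C\<^sup>k\<close>.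
\<close>

lemma Ck_on_mult:
  fixes f g :: "'a::euclidean_space \<Rightarrow> real"
  assumes "open S" "Ck_on k S f" "Ck_on k S g"
  shows "Ck_on k S (\<lambda>x. f x * g x)"
  using assms(2,3)
proof (induction k arbitrary: f g)
  case 0
  then show ?case by (auto intro: continuous_on_mult)
next
  case (Suc k)
  note D = Ck_on_has_derivative[OF Suc.prems(1)] Ck_on_has_derivative[OF Suc.prems(2)]
  have fg: "Ck_on k S f" "Ck_on k S g" using Suc.prems Ck_on_Suc_imp by blast+
  show ?case
    by (rule Ck_on_SucI[OF assms(1) has_derivative_mult[OF D]])
       (use Suc fg in \<open>auto intro!: Ck_on_add[OF assms(1)]\<close>)
qed

lemma Ck_on_affine_precompose:
  assumes "open S" "linear L" "\<And>x. x \<in> S \<Longrightarrow> L x + b \<in> T" "Ck_on k T f"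
  shows "Ck_on k S (\<lambda>x. f (L x + b))"
  using assms(4)
proof (induction k arbitrary: f)
  case 0
  have "continuous_on S (\<lambda>x. L x + b)"
    using assms(2) by (intro continuous_intros linear_continuous_on) (simp add: linear_linear)
  with 0 assms(3) show ?case by (auto intro: continuous_on_compose2)
next
  case (Suc k)
  have L: "((\<lambda>x. L x + b) has_derivative L) (at x)" for x
    using has_derivative_add[OF linear_imp_has_derivative[OF assms(2)] has_derivative_const] by simp
  show ?case
    by (rule Ck_on_SucI[OF assms(1)
          has_derivative_compose[OF L Ck_on_has_derivative[OF Suc.prems assms(3)]]])
       (use Suc in auto)
qed

lemma Ck_on_linear_postcompose:
  assumes "open S" "bounded_linear L" "Ck_on k S f"
  shows "Ck_on k S (\<lambda>x. L (f x))"
  using assms(3)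
proof (induction k arbitrary: f)
  case 0
  then show ?case using assms(2) by (simp add: bounded_linear.continuous_on)
next
  case (Suc k)
  show ?case
    by (rule Ck_on_SucI[OF assms(1)
          bounded_linear.has_derivative[OF assms(2) Ck_on_has_derivative[OF Suc.prems]]])
       (use Suc in auto)
qed

lemma smooth_on_cong:
  "open S \<Longrightarrow> (\<And>x. x \<in> S \<Longrightarrow> f x = g x) \<Longrightarrow> smooth_on S g \<Longrightarrow> smooth_on S f"
  unfolding smooth_on_def by (metis Ck_on_cong)

lemma smooth_on_imp_differentiable: "smooth_on S f \<Longrightarrow> x \<in> S \<Longrightarrow> f differentiable at x"
  unfolding smooth_on_def by (metis Ck_on.simps(2))

lemma smooth_on_const: "open S \<Longrightarrow> smooth_on S (\<lambda>x. c)"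
  by (simp add: smooth_on_def Ck_on_const)

lemma smooth_on_add: "open S \<Longrightarrow> smooth_on S f \<Longrightarrow> smooth_on S g \<Longrightarrow> smooth_on S (\<lambda>x. f x + g x)"
  by (simp add: smooth_on_def Ck_on_add)

lemma smooth_on_mult:
  fixes f g :: "'a::euclidean_space \<Rightarrow> real"
  shows "open S \<Longrightarrow> smooth_on S f \<Longrightarrow> smooth_on S g \<Longrightarrow> smooth_on S (\<lambda>x. f x * g x)"
  by (simp add: smooth_on_def Ck_on_mult)

lemma smooth_on_sum:
  assumes "open S" "\<And>i. i \<in> I \<Longrightarrow> smooth_on S (f i)"
  shows "smooth_on S (\<lambda>x. \<Sum>i\<in>I. f i x)"
  using assms(2)
  by (induction I rule: infinite_finite_induct)
     (auto intro!: smooth_on_const smooth_on_add assms(1))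

lemma smooth_on_affine_precompose:
  "open S \<Longrightarrow> linear L \<Longrightarrow> (\<And>x. x \<in> S \<Longrightarrow> L x + b \<in> T) \<Longrightarrow> smooth_on T f \<Longrightarrow> smooth_on S (\<lambda>x. f (L x + b))"
  unfolding smooth_on_def using Ck_on_affine_precompose by blast

lemma smooth_on_linear_postcompose:
  "open S \<Longrightarrow> bounded_linear L \<Longrightarrow> smooth_on S f \<Longrightarrow> smooth_on S (\<lambda>x. L (f x))"
  by (simp add: smooth_on_def Ck_on_linear_postcompose)


section \<open>Atlases\<close>

lemma atlas_chart:
  assumes "smooth_atlas A" "c \<in> A"
  shows "open (cdom c)" "open (coord c ` cdom c)" "continuous_on (cdom c) (coord c)"
    "continuous_on (coord c ` cdom c) (coord_inv c)"
    "\<And>p. p \<in> cdom c \<Longrightarrow> coord_inv c (coord c p) = p"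
    "\<And>x. x \<in> coord c ` cdom c \<Longrightarrow> coord_inv c x \<in> cdom c"
    "\<And>x. x \<in> coord c ` cdom c \<Longrightarrow> coord c (coord_inv c x) = x"
  using assms unfolding smooth_atlas_def homeomorphism_def by auto

lemma open_coord_image:
  assumes "smooth_atlas A" "c \<in> A" "open U" "U \<subseteq> cdom c"
  shows "open (coord c ` U)"
proof -
  note c = atlas_chart[OF assms(1,2)]
  have "coord c ` U = coord c ` cdom c \<inter> coord_inv c -` U"
    using assms(4) c(5-7) by (auto simp: image_iff)
  then show ?thesis using continuous_open_preimage[OF c(4) c(2) assms(3)] by simp
qed

lemma charts_atD:
  "c \<in> charts_at A p \<Longrightarrow> c \<in> A" "c \<in> charts_at A p \<Longrightarrow> p \<in> cdom c"
  by (auto simp: charts_at_def)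

lemma some_chart_in_charts_at:
  assumes "smooth_atlas A"
  shows "some_chart A p \<in> charts_at A p"
proof -
  have "p \<in> (\<Union>c\<in>A. cdom c)"
    using assms by (simp add: smooth_atlas_def)
  then have "\<exists>c. c \<in> charts_at A p"
    unfolding charts_at_def by blast
  then show ?thesis unfolding some_chart_def by (rule someI_ex)
qed


section \<open>Tangent vectors and the differential of a map\<close>

definition local_rep :: "('a, 'n) chart \<Rightarrow> ('b, 'm) chart \<Rightarrow> ('a \<Rightarrow> 'b) \<Rightarrow> real^'n \<Rightarrow> real^'m"
  where "local_rep c d h = coord d \<circ> h \<circ> coord_inv c"

definition differentiable_map ::
  "('a::topological_space, 'n::finite) chart set \<Rightarrow> ('b::topological_space, 'm::finite) chart set \<Rightarrow>
   ('a \<Rightarrow> 'b) \<Rightarrow> bool"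
  where "differentiable_map A B h \<longleftrightarrow> continuous_on UNIV h \<and>
    (\<forall>p. \<forall>c\<in>charts_at A p. \<forall>d\<in>charts_at B (h p). local_rep c d h differentiable at (coord c p))"

lemma differentiable_mapD:
  assumes "differentiable_map A B h" "c \<in> charts_at A p" "d \<in> charts_at B (h p)"
  shows "(local_rep c d h has_derivative frechet_derivative (local_rep c d h) (at (coord c p)))
    (at (coord c p))"
  using assms unfolding differentiable_map_def frechet_derivative_works by blast

text \<open>
  The identity between the local representations of \<open>k \<circ> h\<close> and of its two factors holds only
  where \<open>h\<close> stays inside the intermediate chart; continuity of \<open>h\<close> makes this an open set, which is
  enough for the chain rule.
\<close>

lemma local_rep_comp_derivative:
  assumes A: "smooth_atlas A" and B: "smooth_atlas B" and C: "smooth_atlas C"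
    and h: "differentiable_map A B h" and k: "differentiable_map B C k"
    and c: "c \<in> charts_at A p" and d: "d \<in> charts_at B (h p)" and e: "e \<in> charts_at C (k (h p))"
  shows "(local_rep c e (k \<circ> h) has_derivative
      (\<lambda>y. frechet_derivative (local_rep d e k) (at (coord d (h p)))
        (frechet_derivative (local_rep c d h) (at (coord c p)) y))) (at (coord c p))"
proof -
  note cA = atlas_chart[OF A charts_atD(1)[OF c]] and cB = atlas_chart[OF B charts_atD(1)[OF d]]
  have p: "local_rep c d h (coord c p) = coord d (h p)"
    using cA(5) charts_atD(2)[OF c] by (simp add: local_rep_def)
  have D: "((\<lambda>x. local_rep d e k (local_rep c d h x)) has_derivative
      (\<lambda>y. frechet_derivative (local_rep d e k) (at (coord d (h p)))
        (frechet_derivative (local_rep c d h) (at (coord c p)) y))) (at (coord c p))"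
    by (rule has_derivative_compose[OF differentiable_mapD[OF h c d]])
       (simp add: p differentiable_mapD[OF k d e])
  define U where "U = cdom c \<inter> h -` cdom d"
  have "open (h -` cdom d)"
    using h cB(1) open_vimage unfolding differentiable_map_def by blast
  then have U: "open (coord c ` U)"
    by (intro open_coord_image[OF A charts_atD(1)[OF c]]) (auto simp: U_def cA(1))
  have "coord c p \<in> coord c ` U" using c d by (auto simp: U_def charts_at_def)
  moreover have "local_rep d e k (local_rep c d h x) = local_rep c e (k \<circ> h) x"
    if "x \<in> coord c ` U" for x
    using that cA(5) cB(5) by (auto simp: local_rep_def U_def)
  ultimately show ?thesis by (rule has_derivative_transform_within_open[OF D U])
qed

lemma frechet_derivative_local_rep_comp:
  assumes "smooth_atlas A" "smooth_atlas B" "smooth_atlas C"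
    "differentiable_map A B h" "differentiable_map B C k"
    "c \<in> charts_at A p" "d \<in> charts_at B (h p)" "e \<in> charts_at C (k (h p))"
  shows "frechet_derivative (local_rep c e (k \<circ> h)) (at (coord c p)) y =
      frechet_derivative (local_rep d e k) (at (coord d (h p)))
        (frechet_derivative (local_rep c d h) (at (coord c p)) y)"
  using frechet_derivative_at[OF local_rep_comp_derivative[OF assms]] by metis

lemma local_rep_id: "local_rep c d id = coord d \<circ> coord_inv c"
  by (simp add: local_rep_def)

lemma differentiable_map_id:
  assumes "smooth_atlas A"
  shows "differentiable_map A A id"
  unfolding differentiable_map_def local_rep_id
proof (intro conjI allI ballI)
  fix p c d assume c: "c \<in> charts_at A p" and d: "d \<in> charts_at A (id p)"
  have "smooth_on (coord c ` (cdom c \<inter> cdom d)) (coord d \<circ> coord_inv c)"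
    using assms c d by (simp add: smooth_atlas_def charts_at_def)
  moreover have "coord c p \<in> coord c ` (cdom c \<inter> cdom d)" using c d by (auto simp: charts_at_def)
  ultimately show "coord d \<circ> coord_inv c differentiable at (coord c p)"
    by (rule smooth_on_imp_differentiable)
qed (simp add: continuous_on_id)

lemma frechet_derivative_transition_self:
  assumes "smooth_atlas A" "c \<in> charts_at A p"
  shows "frechet_derivative (coord c \<circ> coord_inv c) (at (coord c p)) y = y"
proof -
  note c = atlas_chart[OF assms(1) charts_atD(1)[OF assms(2)]]
  have "coord c p \<in> coord c ` cdom c" using assms(2) by (auto simp: charts_at_def)
  then have "((coord c \<circ> coord_inv c) has_derivative (\<lambda>y. y)) (at (coord c p))"
    by (intro has_derivative_transform_within_open[OF has_derivative_ident c(2)]) (auto simp: c)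
  from frechet_derivative_at[OF this] show ?thesis by metis
qed

lemma tangent_of_chart:
  assumes "smooth_atlas A" "c \<in> charts_at A p"
  shows "tangent_of A c p y c = y"
  using assms by (simp add: tangent_of_def frechet_derivative_transition_self)

lemma tangent_space_transition:
  "v \<in> tangent_space A p \<Longrightarrow> c \<in> charts_at A p \<Longrightarrow> d \<in> charts_at A p \<Longrightarrow>
    v d = frechet_derivative (coord d \<circ> coord_inv c) (at (coord c p)) (v c)"
  unfolding tangent_space_def by blast

lemma tangent_space_off_charts: "v \<in> tangent_space A p \<Longrightarrow> c \<notin> charts_at A p \<Longrightarrow> v c = 0"
  unfolding tangent_space_def by blast

text \<open>
  A tangent vector is determined by its components in a single chart: together with
  \<open>tangent_of_chart\<close> this identifies the tangent space at \<open>p\<close> with a coordinate space.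
\<close>

lemma tangent_of_component:
  "v \<in> tangent_space A p \<Longrightarrow> c \<in> charts_at A p \<Longrightarrow> tangent_of A c p (v c) = v"
  by (rule ext) (simp add: tangent_of_def tangent_space_off_charts tangent_space_transition[of v A p c, symmetric])

lemma tangent_space_eqI:
  "v \<in> tangent_space A p \<Longrightarrow> w \<in> tangent_space A p \<Longrightarrow> c \<in> charts_at A p \<Longrightarrow> v c = w c \<Longrightarrow> v = w"
  by (metis tangent_of_component)

text \<open>
  Transition maps are the local representations of the identity, so that the cocycle condition of
  their derivatives is the chain rule for \<open>id \<circ> id\<close>.
\<close>

lemma frechet_derivative_transition_comp:
  assumes "smooth_atlas A" "c \<in> charts_at A p" "d \<in> charts_at A p" "e \<in> charts_at A p"
  shows "frechet_derivative (coord e \<circ> coord_inv c) (at (coord c p)) y =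
    frechet_derivative (coord e \<circ> coord_inv d) (at (coord d p))
      (frechet_derivative (coord d \<circ> coord_inv c) (at (coord c p)) y)"
proof -
  note id = differentiable_map_id[OF assms(1)]
  have "d \<in> charts_at A (id p)" "e \<in> charts_at A (id (id p))" using assms by simp_all
  from frechet_derivative_local_rep_comp[OF assms(1,1,1) id id assms(2) this]
  show ?thesis unfolding comp_id local_rep_id unfolding id_apply .
qed

lemma tangent_of_in_tangent_space:
  assumes "smooth_atlas A" "c \<in> charts_at A p"
  shows "tangent_of A c p y \<in> tangent_space A p"
  unfolding tangent_space_def tangent_of_def mem_Collect_eq
  by (simp add: frechet_derivative_transition_comp[OF assms, symmetric])

lemma linear_transition:
  assumes "smooth_atlas A" "c \<in> charts_at A p" "d \<in> charts_at A p"
  shows "linear (frechet_derivative (coord d \<circ> coord_inv c) (at (coord c p)))"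
  using differentiable_map_id[OF assms(1)] assms(2,3) unfolding differentiable_map_def local_rep_id
  by (auto intro: linear_frechet_derivative)

lemma tangent_of_add:
  assumes "smooth_atlas A" "c \<in> charts_at A p"
  shows "tangent_of A c p (y + z) = (\<lambda>d. tangent_of A c p y d + tangent_of A c p z d)"
  by (rule ext) (simp add: tangent_of_def linear_add[OF linear_transition[OF assms]])

lemma tangent_of_scale:
  assumes "smooth_atlas A" "c \<in> charts_at A p"
  shows "tangent_of A c p (r *\<^sub>R y) = (\<lambda>d. r *\<^sub>R tangent_of A c p y d)"
  by (rule ext) (simp add: tangent_of_def linear_scale[OF linear_transition[OF assms]])

lemma tangent_space_zero:
  assumes "smooth_atlas A"
  shows "(\<lambda>_. 0) \<in> tangent_space A p"
  using linear_0[OF linear_transition[OF assms]] by (auto simp: tangent_space_def)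

text \<open>
  The differential is defined through an arbitrarily chosen chart. Passing to another chart inserts
  the derivative of a transition map, which is exactly the transformation law of the vector.
\<close>

lemma differential_chart:
  assumes A: "smooth_atlas A" and B: "smooth_atlas B" and h: "differentiable_map A B h"
    and v: "v \<in> tangent_space A p" and c: "c \<in> charts_at A p" and d: "d \<in> charts_at B (h p)"
  shows "differential A B h p v d = frechet_derivative (local_rep c d h) (at (coord c p)) (v c)"
proof -
  define c0 where "c0 = some_chart A p"
  have c0: "c0 \<in> charts_at A p" using some_chart_in_charts_at[OF A] by (simp add: c0_def)
  have "differential A B h p v d = frechet_derivative (local_rep c0 d h) (at (coord c0 p)) (v c0)"
    using d by (simp add: differential_def Let_def c0_def local_rep_def)
  also have "\<dots> = frechet_derivative (local_rep c d h) (at (coord c p))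
      (frechet_derivative (coord c \<circ> coord_inv c0) (at (coord c0 p)) (v c0))"
  proof -
    have "c \<in> charts_at A (id p)" "d \<in> charts_at B (h (id p))" using c d by simp_all
    from frechet_derivative_local_rep_comp[OF A A B differentiable_map_id[OF A] h c0 this]
    show ?thesis unfolding comp_id local_rep_id unfolding id_apply .
  qed
  finally show ?thesis unfolding tangent_space_transition[OF v c0 c] .
qed

lemma differential_off_charts: "d \<notin> charts_at B (h p) \<Longrightarrow> differential A B h p v d = 0"
  by (simp add: differential_def)

lemma differential_eq_tangent_of:
  assumes A: "smooth_atlas A" and B: "smooth_atlas B" and h: "differentiable_map A B h"
    and v: "v \<in> tangent_space A p" and c: "c \<in> charts_at A p" and d: "d \<in> charts_at B (h p)"
  shows "differential A B h p v =
    tangent_of B d (h p) (frechet_derivative (local_rep c d h) (at (coord c p)) (v c))"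
proof
  fix e
  show "differential A B h p v e =
    tangent_of B d (h p) (frechet_derivative (local_rep c d h) (at (coord c p)) (v c)) e"
  proof (cases "e \<in> charts_at B (h p)")
    case e: True
    have "differential A B h p v e = frechet_derivative (local_rep c e h) (at (coord c p)) (v c)"
      by (rule differential_chart[OF A B h v c e])
    also have "\<dots> = frechet_derivative (coord e \<circ> coord_inv d) (at (coord d (h p)))
        (frechet_derivative (local_rep c d h) (at (coord c p)) (v c))"
    proof -
      have "e \<in> charts_at B (id (h p))" using e by simp
      from frechet_derivative_local_rep_comp[OF A B B h differentiable_map_id[OF B] c d this]
      show ?thesis unfolding id_comp local_rep_id unfolding id_apply .
    qed
    finally show ?thesis using e by (simp add: tangent_of_def)
  qed (simp add: differential_off_charts tangent_of_def)
qed

lemma differential_in_tangent_space: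
  assumes "smooth_atlas A" "smooth_atlas B" "differentiable_map A B h" "v \<in> tangent_space A p"
  shows "differential A B h p v \<in> tangent_space B (h p)"
  unfolding differential_eq_tangent_of[OF assms some_chart_in_charts_at[OF assms(1)]
      some_chart_in_charts_at[OF assms(2)]]
  by (rule tangent_of_in_tangent_space[OF assms(2) some_chart_in_charts_at[OF assms(2)]])

lemma differential_add:
  assumes "smooth_atlas A" "differentiable_map A B h"
  shows "differential A B h p (\<lambda>c. u c + v c) =
    (\<lambda>d. differential A B h p u d + differential A B h p v d)"
proof
  fix d
  have "linear (frechet_derivative (local_rep (some_chart A p) d h) (at (coord (some_chart A p) p)))"
    if "d \<in> charts_at B (h p)"
    using assms(2) some_chart_in_charts_at[OF assms(1)] that unfolding differentiable_map_def
    by (blast intro: linear_frechet_derivative)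
  from linear_add[OF this]
  show "differential A B h p (\<lambda>c. u c + v c) d =
      differential A B h p u d + differential A B h p v d"
    by (simp add: differential_def Let_def local_rep_def)
qed

lemma differential_scale:
  assumes "smooth_atlas A" "differentiable_map A B h"
  shows "differential A B h p (\<lambda>c. r *\<^sub>R u c) = (\<lambda>d. r *\<^sub>R differential A B h p u d)"
proof
  fix d
  have "linear (frechet_derivative (local_rep (some_chart A p) d h) (at (coord (some_chart A p) p)))"
    if "d \<in> charts_at B (h p)"
    using assms(2) some_chart_in_charts_at[OF assms(1)] that unfolding differentiable_map_def
    by (blast intro: linear_frechet_derivative)
  from linear_scale[OF this]
  show "differential A B h p (\<lambda>c. r *\<^sub>R u c) d = r *\<^sub>R differential A B h p u d"
    by (simp add: differential_def Let_def local_rep_def)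
qed

lemma differential_zero:
  assumes "smooth_atlas A" "differentiable_map A B h"
  shows "differential A B h p (\<lambda>_. 0) = (\<lambda>_. 0)"
  using differential_scale[OF assms, of p 0 "\<lambda>_. 0"] by simp

lemma differential_comp:
  assumes A: "smooth_atlas A" and B: "smooth_atlas B" and C: "smooth_atlas C"
    and h: "differentiable_map A B h" and k: "differentiable_map B C k"
    and v: "v \<in> tangent_space A p"
  shows "differential B C k (h p) (differential A B h p v) = differential A C (k \<circ> h) p v"
proof
  fix e
  define c d where "c = some_chart A p" and "d = some_chart B (h p)"
  have c: "c \<in> charts_at A p" and d: "d \<in> charts_at B (h p)"
    using some_chart_in_charts_at A B by (auto simp: c_def d_def)
  show "differential B C k (h p) (differential A B h p v) e = differential A C (k \<circ> h) p v e"
  proof (cases "e \<in> charts_at C (k (h p))")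
    case e: True
    have "differential A C (k \<circ> h) p v e =
        frechet_derivative (local_rep c e (k \<circ> h)) (at (coord c p)) (v c)"
      using e by (simp add: differential_def Let_def c_def local_rep_def)
    also have "\<dots> = frechet_derivative (local_rep d e k) (at (coord d (h p)))
        (differential A B h p v d)"
      unfolding differential_chart[OF A B h v c d]
      by (rule frechet_derivative_local_rep_comp[OF A B C h k c d e])
    also have "\<dots> = differential B C k (h p) (differential A B h p v) e"
      using e by (simp add: differential_def Let_def d_def local_rep_def)
    finally show ?thesis by simp
  qed (simp add: differential_off_charts)
qed

lemma differential_id:
  assumes "smooth_atlas A" "v \<in> tangent_space A p"
  shows "differential A A id p v = v"
proof -
  note c = some_chart_in_charts_at[OF assms(1), of p]
  have "differential A A id p v =
      tangent_of A (some_chart A p) p (v (some_chart A p))"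
    using differential_eq_tangent_of[OF assms(1,1) differentiable_map_id[OF assms(1)] assms(2) c,
        of "some_chart A p"] c
    by (simp add: local_rep_id frechet_derivative_transition_self[OF assms(1) c])
  then show ?thesis using tangent_of_component[OF assms(2) c] by simp
qed

lemma differential_const: "differential A B (\<lambda>_. q) p v = (\<lambda>_. 0)"
  by (simp add: differential_def Let_def comp_def fun_eq_iff)


section \<open>Maps that are affine in charts\<close>

text \<open>
  The projections of a product and the inclusions of its slices become affine maps once the chart
  of the target is chosen to match the chart of the source. For such maps smoothness of a
  composition follows by induction on the order of differentiability, with a constant derivative in
  place of the general chain rule for higher derivatives.
\<close>

definition affine_in_charts ::
  "('a::topological_space, 'n::finite) chart set \<Rightarrow> ('b::topological_space, 'm::finite) chart set \<Rightarrow>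
   ('a \<Rightarrow> 'b) \<Rightarrow> bool"
  where "affine_in_charts A B h \<longleftrightarrow> continuous_on UNIV h \<and>
    (\<forall>c\<in>A. \<exists>d\<in>B. h ` cdom c \<subseteq> cdom d \<and>
      (\<exists>L b. linear L \<and> (\<forall>p\<in>cdom c. coord d (h p) = L (coord c p) + b)))"

lemma affine_in_chartsE:
  assumes "affine_in_charts A B h" "c \<in> A"
  obtains d L b where "d \<in> B" "h ` cdom c \<subseteq> cdom d" "linear L"
    "\<And>p. p \<in> cdom c \<Longrightarrow> coord d (h p) = L (coord c p) + b"
  using assms unfolding affine_in_charts_def by blast

lemma has_derivative_affine:
  fixes L :: "'a::euclidean_space \<Rightarrow> 'b::real_normed_vector"
  assumes "linear L"
  shows "((\<lambda>x. L x + b) has_derivative L) (at x)"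
  using has_derivative_add[OF linear_imp_has_derivative[OF assms] has_derivative_const] by simp

text \<open>
  The hypothesis speaks of one target chart only; any other target chart differs from it by a
  transition map, near every point that \<open>h\<close> maps into both.
\<close>

lemma affine_in_charts_imp_differentiable_map:
  assumes A: "smooth_atlas A" and B: "smooth_atlas B" and h: "affine_in_charts A B h"
  shows "differentiable_map A B h"
  unfolding differentiable_map_def
proof (intro conjI allI ballI)
  show cont: "continuous_on UNIV h" using h by (simp add: affine_in_charts_def)
  fix p c e assume c: "c \<in> charts_at A p" and e: "e \<in> charts_at B (h p)"
  obtain d L b where d: "d \<in> B" "h ` cdom c \<subseteq> cdom d" and L: "linear L"
    and eq: "\<And>p. p \<in> cdom c \<Longrightarrow> coord d (h p) = L (coord c p) + b"
    using affine_in_chartsE[OF h charts_atD(1)[OF c]] by blast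
  note cA = atlas_chart[OF A charts_atD(1)[OF c]] and dB = atlas_chart[OF B d(1)]
    and eB = atlas_chart[OF B charts_atD(1)[OF e]]
  have d': "d \<in> charts_at B (h p)"
    using d c by (auto simp: charts_at_def)
  have e': "e \<in> charts_at B (id (h p))" using e by simp
  have "(local_rep d e id has_derivative frechet_derivative (local_rep d e id) (at (coord d (h p))))
      (at (L (coord c p) + b))"
    using differentiable_mapD[OF differentiable_map_id[OF B] d' e']
    unfolding eq[OF charts_atD(2)[OF c]] .
  from has_derivative_compose[OF has_derivative_affine[OF L] this]
  have D: "((\<lambda>x. local_rep d e id (L x + b)) has_derivative
      (\<lambda>y. frechet_derivative (local_rep d e id) (at (coord d (h p))) (L y))) (at (coord c p))" .
  define U where "U = cdom c \<inter> h -` cdom e"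
  have "open (h -` cdom e)" using cont eB(1) open_vimage by blast
  then have U: "open (coord c ` U)"
    by (intro open_coord_image[OF A charts_atD(1)[OF c]]) (auto simp: U_def cA(1))
  have pU: "coord c p \<in> coord c ` U" using c e by (auto simp: U_def charts_at_def)
  have "local_rep d e id (L x + b) = local_rep c e h x" if x: "x \<in> coord c ` U" for x
  proof -
    obtain q where q: "q \<in> cdom c" "x = coord c q" using x by (auto simp: U_def)
    then have "coord_inv d (L x + b) = h q" using eq dB(5) d(2) by (metis image_subset_iff)
    then show ?thesis using q cA(5) by (simp add: local_rep_def)
  qed
  from has_derivative_transform_within_open[OF D U pU this]
  show "local_rep c e h differentiable at (coord c p)" by (auto simp: differentiable_def)
qed

lemma frechet_derivative_affine_local_rep:
  assumes A: "smooth_atlas A" and c: "c \<in> charts_at A p" and L: "linear L"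
    and eq: "\<And>p. p \<in> cdom c \<Longrightarrow> coord d (h p) = L (coord c p) + b"
  shows "frechet_derivative (local_rep c d h) (at (coord c p)) = L"
proof -
  note cA = atlas_chart[OF A charts_atD(1)[OF c]]
  have "coord c p \<in> coord c ` cdom c" using c by (auto simp: charts_at_def)
  moreover have "L x + b = local_rep c d h x" if "x \<in> coord c ` cdom c" for x
    using that cA(6,7) eq[of "coord_inv c x"] by (simp add: local_rep_def)
  ultimately have "(local_rep c d h has_derivative L) (at (coord c p))"
    by (rule has_derivative_transform_within_open[OF has_derivative_affine[OF L] cA(2)])
  then show ?thesis by (rule frechet_derivative_at[symmetric])
qed

lemma smooth_fun_comp_affine:
  assumes A: "smooth_atlas A" and B: "smooth_atlas B" and h: "affine_in_charts A B h"
    and f: "smooth_fun B f"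
  shows "smooth_fun A (f \<circ> h)"
  unfolding smooth_fun_def
proof
  fix c assume c: "c \<in> A"
  obtain d L b where d: "d \<in> B" "h ` cdom c \<subseteq> cdom d" and L: "linear L"
    and eq: "\<And>p. p \<in> cdom c \<Longrightarrow> coord d (h p) = L (coord c p) + b"
    using affine_in_chartsE[OF h c] by blast
  note cA = atlas_chart[OF A c] and dB = atlas_chart[OF B d(1)]
  have Lx: "L x + b = coord d (h (coord_inv c x))" "h (coord_inv c x) \<in> cdom d"
    if "x \<in> coord c ` cdom c" for x
    using that cA(6,7) eq[of "coord_inv c x"] d(2) by auto
  have "smooth_on (coord c ` cdom c) (\<lambda>x. (f \<circ> coord_inv d) (L x + b))"
    by (rule smooth_on_affine_precompose[OF cA(2) L, where T = "coord d ` cdom d"])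
       (use Lx f d(1) in \<open>auto simp: smooth_fun_def comp_def\<close>)
  then show "smooth_on (coord c ` cdom c) (f \<circ> h \<circ> coord_inv c)"
    by (rule smooth_on_cong[OF cA(2), rotated]) (simp add: Lx dB(5))
qed


section \<open>Inner products on tangent spaces and their pullback\<close>

lemma inner_product_onD:
  assumes "inner_product_on V g"
  shows "u \<in> V \<Longrightarrow> v \<in> V \<Longrightarrow> g u v = g v u"
    "u \<in> V \<Longrightarrow> v \<in> V \<Longrightarrow> w \<in> V \<Longrightarrow> g (\<lambda>c. u c + v c) w = g u w + g v w"
    "u \<in> V \<Longrightarrow> w \<in> V \<Longrightarrow> g (\<lambda>c. r *\<^sub>R u c) w = r * g u w"
    "u \<in> V \<Longrightarrow> u \<noteq> (\<lambda>_. 0) \<Longrightarrow> g u u > 0"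
  using assms unfolding inner_product_on_def by blast+

lemma inner_product_on_zero:
  assumes "inner_product_on V g" "(\<lambda>_. 0) \<in> V" "w \<in> V"
  shows "g (\<lambda>_. 0) w = 0"
  using inner_product_onD(3)[OF assms, of 0] by simp

lemma inner_product_on_nonneg:
  assumes "inner_product_on V g" "u \<in> V"
  shows "g u u \<ge> 0"
  using inner_product_onD(4)[OF assms] inner_product_on_zero[OF assms(1) _ assms(2)] assms(2)
  by (cases "u = (\<lambda>_. 0)") (auto intro: less_imp_le)

text \<open>
  Bilinearity and symmetry reduce the metric to its components, which is what turns smoothness of
  the components into smoothness of the pulled back metric.
\<close>

lemma inner_product_in_coords:
  assumes A: "smooth_atlas A" and c: "c \<in> charts_at A p"
    and g: "inner_product_on (tangent_space A p) (g p)"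
  shows "g p (tangent_of A c p y) (tangent_of A c p z) =
    (\<Sum>k\<in>UNIV. \<Sum>l\<in>UNIV. y $ k * z $ l * metric_component A g c k l (coord c p))"
proof -
  let ?T = "tangent_of A c p"
  note [simp] = tangent_of_in_tangent_space[OF A c]
  have lin: "linear (\<lambda>y. g p (?T y) w)" if "w \<in> tangent_space A p" for w
    by (rule linearI)
       (simp_all add: tangent_of_add[OF A c] tangent_of_scale[OF A c] inner_product_onD[OF g] that)
  have expand: "g p (?T y) w = (\<Sum>k\<in>UNIV. y $ k * g p (?T (axis k 1)) w)"
    if "w \<in> tangent_space A p" for y w
  proof -
    have "g p (?T (\<Sum>k\<in>UNIV. y $ k *\<^sub>R axis k 1)) w = (\<Sum>k\<in>UNIV. y $ k * g p (?T (axis k 1)) w)"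
      by (simp add: linear_sum[OF lin[OF that]] linear_scale[OF lin[OF that]])
    then show ?thesis using basis_expansion[of y] by (simp add: scalar_mult_eq_scaleR)
  qed
  have comp: "g p (?T (axis k 1)) (?T (axis l 1)) = metric_component A g c k l (coord c p)" for k l
    using atlas_chart(5)[OF A charts_atD(1)[OF c] charts_atD(2)[OF c]]
    by (simp add: metric_component_def)
  have "g p (?T (axis k 1)) (?T z) = (\<Sum>l\<in>UNIV. z $ l * metric_component A g c k l (coord c p))" for k
  proof -
    have "g p (?T (axis k 1)) (?T z) = (\<Sum>l\<in>UNIV. z $ l * g p (?T (axis l 1)) (?T (axis k 1)))"
      using inner_product_onD(1)[OF g, of "?T (axis k 1)" "?T z"] expand[of "?T (axis k 1)" z] by simp
    also have "\<dots> = (\<Sum>l\<in>UNIV. z $ l * g p (?T (axis k 1)) (?T (axis l 1)))"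
      by (intro sum.cong refl arg_cong2[where f = "(*)"] inner_product_onD(1)[OF g]) simp_all
    finally show ?thesis by (simp add: comp)
  qed
  then show ?thesis
    using expand[of "?T z" y] by (simp add: sum_distrib_left mult.assoc)
qed

definition pullback ::
  "('a, 'n::finite) chart set \<Rightarrow> ('b, 'm::finite) chart set \<Rightarrow> ('a \<Rightarrow> 'b) \<Rightarrow>
   ('b \<Rightarrow> ('b, 'm) tangent \<Rightarrow> ('b, 'm) tangent \<Rightarrow> real) \<Rightarrow>
   'a \<Rightarrow> ('a, 'n) tangent \<Rightarrow> ('a, 'n) tangent \<Rightarrow> real"
  where "pullback A B h g p u v = g (h p) (differential A B h p u) (differential A B h p v)"

text \<open>
  With \<open>h\<close> given by \<open>x \<mapsto> L x + b\<close> in charts, the components of the pullback are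
  \<open>\<Sum>k l. L\<^sub>k\<^sub>i L\<^sub>l\<^sub>j g\<^sub>k\<^sub>l (L x + b)\<close>: linear combinations, with constant coefficients, of
  the components of \<open>g\<close> composed with an affine map.
\<close>

lemma smooth_pullback:
  assumes A: "smooth_atlas A" and B: "smooth_atlas B" and h: "affine_in_charts A B h"
    and g: "\<And>q. inner_product_on (tangent_space B q) (g q)"
    and smooth: "\<And>d k l. d \<in> B \<Longrightarrow> smooth_on (coord d ` cdom d) (metric_component B g d k l)"
    and c: "c \<in> A"
  shows "smooth_on (coord c ` cdom c) (metric_component A (pullback A B h g) c i j)"
proof -
  obtain d L b where d: "d \<in> B" "h ` cdom c \<subseteq> cdom d" and L: "linear L"
    and eq: "\<And>p. p \<in> cdom c \<Longrightarrow> coord d (h p) = L (coord c p) + b"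
    using affine_in_chartsE[OF h c] by blast
  note cA = atlas_chart[OF A c] and hd = affine_in_charts_imp_differentiable_map[OF A B h]
  have comp: "metric_component A (pullback A B h g) c i j x =
      (\<Sum>k\<in>UNIV. \<Sum>l\<in>UNIV. L (axis i 1) $ k * L (axis j 1) $ l * metric_component B g d k l (L x + b))"
    if x: "x \<in> coord c ` cdom c" for x
  proof -
    define p where "p = coord_inv c x"
    have p: "p \<in> cdom c" "coord c p = x" using cA(6,7)[OF x] by (simp_all add: p_def)
    have cp: "c \<in> charts_at A p" and dp: "d \<in> charts_at B (h p)"
      using c d p by (auto simp: charts_at_def)
    have "frechet_derivative (local_rep c d h) (at (coord c p)) = L"
      by (rule frechet_derivative_affine_local_rep[OF A cp L eq])
    then have "differential A B h p (tangent_of A c p y) = tangent_of B d (h p) (L y)" for y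
      by (simp add: tangent_of_chart[OF A cp]
          differential_eq_tangent_of[OF A B hd tangent_of_in_tangent_space[OF A cp] cp dp])
    then have "metric_component A (pullback A B h g) c i j x =
        g (h p) (tangent_of B d (h p) (L (axis i 1))) (tangent_of B d (h p) (L (axis j 1)))"
      by (simp add: metric_component_def Let_def pullback_def p_def)
    then show ?thesis
      unfolding inner_product_in_coords[where g = g, OF B dp g] eq[OF p(1)] p(2) .
  qed
  have "smooth_on (coord c ` cdom c) (\<lambda>x. metric_component B g d k l (L x + b))" for k l
  proof (rule smooth_on_affine_precompose[OF cA(2) L _ smooth[OF d(1)]])
    fix x assume "x \<in> coord c ` cdom c"
    then show "L x + b \<in> coord d ` cdom d" using eq d(2) by (auto simp flip: eq)
  qed
  then have "smooth_on (coord c ` cdom c) (\<lambda>x.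
      \<Sum>k\<in>UNIV. \<Sum>l\<in>UNIV. L (axis i 1) $ k * L (axis j 1) $ l * metric_component B g d k l (L x + b))"
    by (intro smooth_on_sum smooth_on_mult smooth_on_const cA(2))
  then show ?thesis by (rule smooth_on_cong[OF cA(2), rotated]) (rule comp)
qed

text \<open>
  A metric restricts along an immersion: injectivity of the differential is what keeps the pulled
  back form positive definite.
\<close>

lemma riemannian_restrict:
  assumes A: "smooth_atlas A" and B: "smooth_atlas B" and h: "affine_in_charts A B h"
    and inj: "\<And>p v. v \<in> tangent_space A p \<Longrightarrow> differential A B h p v = (\<lambda>_. 0) \<Longrightarrow> v = (\<lambda>_. 0)"
    and F: "riemannian B F"
  shows "riemannian A (\<lambda>p v. F (h p) (differential A B h p v))"
proof -
  note hd = affine_in_charts_imp_differentiable_map[OF A B h]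
  obtain g where g: "\<And>q. inner_product_on (tangent_space B q) (g q)"
    and smooth: "\<And>d k l. d \<in> B \<Longrightarrow> smooth_on (coord d ` cdom d) (metric_component B g d k l)"
    and Fg: "\<And>q v. v \<in> tangent_space B q \<Longrightarrow> F q v = sqrt (g q v v)"
    using F unfolding riemannian_def by blast
  note T = differential_in_tangent_space[OF A B hd]
  have "inner_product_on (tangent_space A p) (pullback A B h g p)" for p
    unfolding inner_product_on_def pullback_def
  proof (intro conjI ballI allI impI)
    fix u assume "u \<in> tangent_space A p" "u \<noteq> (\<lambda>_. 0)"
    then show "0 < g (h p) (differential A B h p u) (differential A B h p u)"
      by (intro inner_product_onD(4)[OF g] T) (auto dest: inj)
  qed (simp_all add: differential_add[OF A hd] differential_scale[OF A hd] T
        inner_product_onD(2,3)[OF g] inner_product_onD(1)[OF g T T])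
  then show ?thesis
    unfolding riemannian_def using smooth_pullback[OF A B h g smooth] Fg[OF T]
    by (intro exI[of _ "pullback A B h g"]) (auto simp: pullback_def)
qed

lemma riemannian_scale:
  assumes A: "smooth_atlas A" and F: "riemannian A F" and r: "r > 0"
    and eq: "\<And>p v. v \<in> tangent_space A p \<Longrightarrow> F' p v = r * F p v"
  shows "riemannian A F'"
proof -
  obtain g where g: "\<And>p. inner_product_on (tangent_space A p) (g p)"
    and smooth: "\<And>c k l. c \<in> A \<Longrightarrow> smooth_on (coord c ` cdom c) (metric_component A g c k l)"
    and Fg: "\<And>p v. v \<in> tangent_space A p \<Longrightarrow> F p v = sqrt (g p v v)"
    using F unfolding riemannian_def by blast
  have mc: "metric_component A (\<lambda>p u v. r\<^sup>2 * g p u v) c i j = (\<lambda>x. r\<^sup>2 * metric_component A g c i j x)"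
    for c i j by (simp add: metric_component_def Let_def fun_eq_iff)
  show ?thesis
    unfolding riemannian_def
  proof (intro exI[of _ "\<lambda>p u v. r\<^sup>2 * g p u v"] conjI allI ballI)
    show "inner_product_on (tangent_space A p) (\<lambda>u v. r\<^sup>2 * g p u v)" for p
      using g[of p] r unfolding inner_product_on_def by (simp add: algebra_simps)
    show "smooth_on (coord c ` cdom c) (metric_component A (\<lambda>p u v. r\<^sup>2 * g p u v) c i j)"
      if "c \<in> A" for c i j
      unfolding mc using atlas_chart(2)[OF A that] smooth[OF that]
      by (intro smooth_on_mult smooth_on_const)
    show "F' p v = sqrt (r\<^sup>2 * g p v v)" if "v \<in> tangent_space A p" for p v
      using eq[OF that] Fg[OF that] r by (simp add: real_sqrt_mult)
  qed
qed


section \<open>The product manifold\<close>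

definition proj1 :: "real^('n::finite + 'm::finite) \<Rightarrow> real^'n" where "proj1 z = (\<chi> a. z $ Inl a)"
definition proj2 :: "real^('n::finite + 'm::finite) \<Rightarrow> real^'m" where "proj2 z = (\<chi> b. z $ Inr b)"
definition emb1 :: "real^'n::finite \<Rightarrow> real^('n + 'm::finite)"
  where "emb1 x = (\<chi> i. case i of Inl a \<Rightarrow> x $ a | Inr b \<Rightarrow> 0)"
definition emb2 :: "real^'m::finite \<Rightarrow> real^('n::finite + 'm)"
  where "emb2 y = (\<chi> i. case i of Inl a \<Rightarrow> 0 | Inr b \<Rightarrow> y $ b)"

lemma linear_proj_emb: "linear proj1" "linear proj2" "linear emb1" "linear emb2"
  by (auto intro!: linearI simp: proj1_def proj2_def emb1_def emb2_def vec_eq_iff split: sum.split)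

lemma proj_emb [simp]:
  "proj1 (emb1 x + emb2 y) = x" "proj2 (emb1 x + emb2 y) = y" "emb1 (proj1 z) + emb2 (proj2 z) = z"
  by (auto simp: proj1_def proj2_def emb1_def emb2_def vec_eq_iff split: sum.split)

lemma cdom_product_chart [simp]: "cdom (product_chart c1 c2) = cdom c1 \<times> cdom c2"
  by (simp add: product_chart_def)

lemma coord_product_chart [simp]:
  "coord (product_chart c1 c2) (p, q) = emb1 (coord c1 p) + emb2 (coord c2 q)"
  by (auto simp: product_chart_def emb1_def emb2_def vec_eq_iff split: sum.split)

lemma product_atlasE:
  assumes "c \<in> product_atlas A1 A2"
  obtains c1 c2 where "c = product_chart c1 c2" "c1 \<in> A1" "c2 \<in> A2"
  using assms by (auto simp: product_atlas_def)

lemma product_chart_in_product_atlas: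
  "c1 \<in> A1 \<Longrightarrow> c2 \<in> A2 \<Longrightarrow> product_chart c1 c2 \<in> product_atlas A1 A2"
  unfolding product_atlas_def by blast

lemma coord_product_chart_image:
  "coord (product_chart c1 c2) ` (U \<times> V) = proj1 -` (coord c1 ` U) \<inter> proj2 -` (coord c2 ` V)"
proof safe
  fix z p q assume z: "proj1 z = coord c1 p" "proj2 z = coord c2 q" and pq: "p \<in> U" "q \<in> V"
  have "z = coord (product_chart c1 c2) (p, q)"
    unfolding coord_product_chart z[symmetric] proj_emb ..
  then show "z \<in> coord (product_chart c1 c2) ` (U \<times> V)" using pq by blast
qed auto

text \<open>
  \<open>coord_inv\<close> is a choice of preimage; injectivity of the product chart forces it to be the pair
  of the two inverses.
\<close>

lemma coord_inv_product_chart: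
  assumes "smooth_atlas A1" "smooth_atlas A2" "c1 \<in> A1" "c2 \<in> A2"
    and z: "z \<in> coord (product_chart c1 c2) ` (cdom c1 \<times> cdom c2)"
  shows "coord_inv (product_chart c1 c2) z = (coord_inv c1 (proj1 z), coord_inv c2 (proj2 z))"
proof -
  note c1 = atlas_chart[OF assms(1,3)] and c2 = atlas_chart[OF assms(2,4)]
  have "inj_on (coord (product_chart c1 c2)) (cdom c1 \<times> cdom c2)"
    by (rule inj_on_inverseI[where g = "\<lambda>z. (coord_inv c1 (proj1 z), coord_inv c2 (proj2 z))"])
       (auto simp: c1 c2)
  then show ?thesis
    unfolding coord_inv_def[of "product_chart c1 c2"] cdom_product_chart
    using z by (auto simp: c1 c2 simp del: coord_product_chart)
      (simp_all add: c1 c2)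
qed

lemma smooth_atlas_product:
  fixes A1 :: "('a::{t2_space, second_countable_topology}, 'n::finite) chart set"
    and A2 :: "('b::{t2_space, second_countable_topology}, 'm::finite) chart set"
  assumes A1: "smooth_atlas A1" and A2: "smooth_atlas A2"
  shows "smooth_atlas (product_atlas A1 A2)"
  unfolding smooth_atlas_def
proof (intro conjI ballI)
  have open_image: "open (coord (product_chart c1 c2) ` (U \<times> V))"
    if "c1 \<in> A1" "c2 \<in> A2" "open U" "open V" "U \<subseteq> cdom c1" "V \<subseteq> cdom c2" for c1 c2 U V
    unfolding coord_product_chart_image using that
    by (intro open_Int open_vimage open_coord_image[OF A1] open_coord_image[OF A2]
        linear_continuous_on) (auto simp: linear_proj_emb linear_linear)
  have cov1: "(\<Union>c\<in>A1. cdom c) = UNIV" and cov2: "(\<Union>c\<in>A2. cdom c) = UNIV"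
    using A1 A2 by (simp_all add: smooth_atlas_def)
  show "(\<Union>c\<in>product_atlas A1 A2. cdom c) = UNIV"
  proof (intro set_eqI iffI UNIV_I)
    fix x :: "'a \<times> 'b"
    obtain c1 where c1: "c1 \<in> A1" "fst x \<in> cdom c1" using cov1 by blast
    obtain c2 where c2: "c2 \<in> A2" "snd x \<in> cdom c2" using cov2 by blast
    have "x \<in> cdom (product_chart c1 c2)" using c1 c2 by (simp add: mem_Times_iff)
    then show "x \<in> (\<Union>c\<in>product_atlas A1 A2. cdom c)"
      using product_chart_in_product_atlas[OF c1(1) c2(1)] by blast
  qed
  fix c assume "c \<in> product_atlas A1 A2"
  then obtain c1 c2 where c: "c = product_chart c1 c2" and m: "c1 \<in> A1" "c2 \<in> A2"
    by (rule product_atlasE)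
  note c1 = atlas_chart[OF A1 m(1)] and c2 = atlas_chart[OF A2 m(2)]
  note inv = coord_inv_product_chart[OF A1 A2 m]
  show "open (cdom c)" using c1 c2 by (simp add: c open_Times)
  show "open (coord c ` cdom c)" using open_image[OF m] c1(1) c2(1) by (simp add: c)
  have lin: "continuous_on S proj1" "continuous_on S proj2" "continuous_on T emb1" "continuous_on T' emb2"
    for S :: "(real^('n + 'm)) set" and T :: "(real^'n) set" and T' :: "(real^'m) set"
    by (auto intro: linear_continuous_on simp: linear_proj_emb linear_linear)
  show "homeomorphism (cdom c) (coord c ` cdom c) (coord c) (coord_inv c)"
    unfolding homeomorphism_def
  proof (intro conjI ballI)
    have "continuous_on (cdom c) (\<lambda>x. emb1 (coord c1 (fst x)) + emb2 (coord c2 (snd x)))"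
      by (intro continuous_on_add continuous_on_compose2[OF lin(3)[of UNIV]]
          continuous_on_compose2[OF lin(4)[of UNIV]] continuous_on_compose2[OF c1(3)]
          continuous_on_compose2[OF c2(3)] continuous_on_fst continuous_on_snd continuous_on_id) (auto simp: c)
    then show "continuous_on (cdom c) (coord c)"
      by (rule continuous_on_eq) (auto simp: c)
    have "continuous_on (coord c ` cdom c) (\<lambda>z. (coord_inv c1 (proj1 z), coord_inv c2 (proj2 z)))"
      by (intro continuous_on_Pair continuous_on_compose2[OF c1(4) lin(1)]
          continuous_on_compose2[OF c2(4) lin(2)]) (auto simp: c)
    then show "continuous_on (coord c ` cdom c) (coord_inv c)"
      by (rule continuous_on_eq) (simp add: c inv)
    have left: "coord_inv c (coord c x) = x" if "x \<in> cdom c" for x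
    proof -
      have "coord c x \<in> coord (product_chart c1 c2) ` (cdom c1 \<times> cdom c2)" using that by (auto simp: c)
      from inv[OF this] show ?thesis using that by (auto simp: c c1 c2)
    qed
    then show "coord_inv c (coord c x) = x" if "x \<in> cdom c" for x using that .
    show "coord c (coord_inv c z) = z" if "z \<in> coord c ` cdom c" for z
      using left that by auto
    show "coord_inv c ` coord c ` cdom c = cdom c" using left by (force simp: image_iff)
  qed simp
  fix d assume "d \<in> product_atlas A1 A2"
  then obtain d1 d2 where d: "d = product_chart d1 d2" and n: "d1 \<in> A1" "d2 \<in> A2"
    by (rule product_atlasE)
  let ?U1 = "cdom c1 \<inter> cdom d1" and ?U2 = "cdom c2 \<inter> cdom d2"
  let ?Z = "coord c ` (?U1 \<times> ?U2)"
  have Z: "open ?Z"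
    unfolding c by (rule open_image[OF m])
      (use c1 c2 atlas_chart[OF A1 n(1)] atlas_chart[OF A2 n(2)] in auto)
  have s1: "smooth_on (coord c1 ` ?U1) (coord d1 \<circ> coord_inv c1)"
    and s2: "smooth_on (coord c2 ` ?U2) (coord d2 \<circ> coord_inv c2)"
    using A1 A2 m n by (simp_all add: smooth_atlas_def)
  have p1: "smooth_on ?Z (\<lambda>z. emb1 ((coord d1 \<circ> coord_inv c1) (proj1 z + 0)))"
    by (rule smooth_on_linear_postcompose[OF Z _
          smooth_on_affine_precompose[OF Z linear_proj_emb(1) _ s1]])
       (auto simp: c linear_proj_emb linear_linear)
  have p2: "smooth_on ?Z (\<lambda>z. emb2 ((coord d2 \<circ> coord_inv c2) (proj2 z + 0)))"
    by (rule smooth_on_linear_postcompose[OF Z _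
          smooth_on_affine_precompose[OF Z linear_proj_emb(2) _ s2]])
       (auto simp: c linear_proj_emb linear_linear)
  have "smooth_on ?Z (coord d \<circ> coord_inv c)"
  proof (rule smooth_on_cong[OF Z _ smooth_on_add[OF Z p1 p2]])
    fix z assume "z \<in> ?Z"
    then have "z \<in> coord (product_chart c1 c2) ` (cdom c1 \<times> cdom c2)" by (auto simp: c)
    from inv[OF this] show "(coord d \<circ> coord_inv c) z =
        emb1 ((coord d1 \<circ> coord_inv c1) (proj1 z + 0)) + emb2 ((coord d2 \<circ> coord_inv c2) (proj2 z + 0))"
      by (simp add: c d)
  qed
  then show "smooth_on (coord c ` (cdom c \<inter> cdom d)) (coord d \<circ> coord_inv c)"
    by (simp add: c d Times_Int_Times)
qed

lemma affine_fst: "affine_in_charts (product_atlas A1 A2) A1 fst"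
  unfolding affine_in_charts_def
proof (intro conjI ballI)
  fix c assume "c \<in> product_atlas A1 A2"
  then obtain c1 c2 where c: "c = product_chart c1 c2" "c1 \<in> A1" "c2 \<in> A2" by (rule product_atlasE)
  then show "\<exists>d\<in>A1. fst ` cdom c \<subseteq> cdom d \<and>
      (\<exists>L b. linear L \<and> (\<forall>p\<in>cdom c. coord d (fst p) = L (coord c p) + b))"
    by (intro bexI[of _ c1] conjI exI[of _ proj1] exI[of _ 0]) (auto simp: linear_proj_emb)
qed (intro continuous_intros)

lemma affine_snd: "affine_in_charts (product_atlas A1 A2) A2 snd"
  unfolding affine_in_charts_def
proof (intro conjI ballI)
  fix c assume "c \<in> product_atlas A1 A2"
  then obtain c1 c2 where c: "c = product_chart c1 c2" "c1 \<in> A1" "c2 \<in> A2" by (rule product_atlasE)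
  then show "\<exists>d\<in>A2. snd ` cdom c \<subseteq> cdom d \<and>
      (\<exists>L b. linear L \<and> (\<forall>p\<in>cdom c. coord d (snd p) = L (coord c p) + b))"
    by (intro bexI[of _ c2] conjI exI[of _ proj2] exI[of _ 0]) (auto simp: linear_proj_emb)
qed (intro continuous_intros)

lemma affine_slice1:
  assumes "smooth_atlas A2"
  shows "affine_in_charts A1 (product_atlas A1 A2) (\<lambda>p. (p, q))"
  unfolding affine_in_charts_def
proof (intro conjI ballI)
  fix c assume c: "c \<in> A1"
  note c2 = some_chart_in_charts_at[OF assms, of q]
  show "\<exists>d\<in>product_atlas A1 A2. (\<lambda>p. (p, q)) ` cdom c \<subseteq> cdom d \<and>
      (\<exists>L b. linear L \<and> (\<forall>p\<in>cdom c. coord d (p, q) = L (coord c p) + b))"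
    by (intro bexI[of _ "product_chart c (some_chart A2 q)"] conjI exI[of _ emb1]
        exI[of _ "emb2 (coord (some_chart A2 q) q)"] product_chart_in_product_atlas c
        charts_atD(1)[OF c2])
      (use charts_atD(2)[OF c2] in \<open>auto simp: linear_proj_emb\<close>)
qed (intro continuous_intros)

lemma affine_slice2:
  assumes "smooth_atlas A1"
  shows "affine_in_charts A2 (product_atlas A1 A2) (\<lambda>q. (p, q))"
  unfolding affine_in_charts_def
proof (intro conjI ballI)
  fix c assume c: "c \<in> A2"
  note c1 = some_chart_in_charts_at[OF assms, of p]
  show "\<exists>d\<in>product_atlas A1 A2. (\<lambda>q. (p, q)) ` cdom c \<subseteq> cdom d \<and>
      (\<exists>L b. linear L \<and> (\<forall>q\<in>cdom c. coord d (p, q) = L (coord c q) + b))"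
    by (intro bexI[of _ "product_chart (some_chart A1 p) c"] conjI exI[of _ emb2]
        exI[of _ "emb1 (coord (some_chart A1 p) p)"] product_chart_in_product_atlas c
        charts_atD(1)[OF c1])
      (use charts_atD(2)[OF c1] in \<open>auto simp: linear_proj_emb\<close>)
qed (intro continuous_intros)

text \<open>
  In a product chart the differentials of the projections read off the two blocks of components, so
  they have no common kernel. This makes the sum of two pulled back metrics definite although
  neither summand is.
\<close>

lemma product_tangent_eq_zero:
  assumes A1: "smooth_atlas A1" and A2: "smooth_atlas A2"
    and v: "v \<in> tangent_space (product_atlas A1 A2) x"
    and "differential (product_atlas A1 A2) A1 fst x v = (\<lambda>_. 0)"
    and "differential (product_atlas A1 A2) A2 snd x v = (\<lambda>_. 0)"
  shows "v = (\<lambda>_. 0)"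
proof -
  note A = smooth_atlas_product[OF A1 A2]
  define c where "c = some_chart (product_atlas A1 A2) x"
  have c: "c \<in> charts_at (product_atlas A1 A2) x" using some_chart_in_charts_at[OF A] by (simp add: c_def)
  obtain c1 c2 where cc: "c = product_chart c1 c2" "c1 \<in> A1" "c2 \<in> A2"
    using charts_atD(1)[OF c] by (rule product_atlasE)
  have c1: "c1 \<in> charts_at A1 (fst x)" and c2: "c2 \<in> charts_at A2 (snd x)"
    using charts_atD(2)[OF c] cc by (auto simp: charts_at_def)
  have e1: "coord c1 (fst p) = proj1 (coord c p) + 0" and e2: "coord c2 (snd p) = proj2 (coord c p) + 0" for p
    by (cases p; simp add: cc)+
  note d1 = affine_in_charts_imp_differentiable_map[OF A A1 affine_fst]
  note d2 = affine_in_charts_imp_differentiable_map[OF A A2 affine_snd]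
  have "proj1 (v c) = 0"
    using differential_chart[OF A A1 d1 v c c1] assms(4)
      frechet_derivative_affine_local_rep[where h = fst and d = c1, OF A c linear_proj_emb(1) e1] by simp
  moreover have "proj2 (v c) = 0"
    using differential_chart[OF A A2 d2 v c c2] assms(5)
      frechet_derivative_affine_local_rep[where h = snd and d = c2, OF A c linear_proj_emb(2) e2] by simp
  ultimately have "v c = 0"
    using proj_emb(3)[of "v c"] by (simp add: linear_0 linear_proj_emb)
  then show ?thesis
    using tangent_space_eqI[OF v tangent_space_zero[OF A] c] by simp
qed


section \<open>The convolution\<close>

text \<open>
  The lower left block of the associated matrix is \<open>0\<close>, so symmetry makes the upper right block
  vanish as well; since \<open>f1\<close> and \<open>f2\<close> are positive, every product of a partial derivative of
  \<open>f1\<close> with one of \<open>f2\<close> is \<open>0\<close>. Each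
  summand of the cross term contains components of both gradients, and these are combinations
  of such partial derivatives; hence the cross term is \<open>0\<close>, for all tangent vectors.
\<close>

lemma convolution_eq:
  assumes A1: "smooth_atlas A1" and A2: "smooth_atlas A2"
    and pos: "\<And>x1. f1 x1 > 0" "\<And>x2. f2 x2 > 0"
    and conv: "convolution_finsler A1 F1 f1 A2 F2 f2"
  shows "convolution A1 F1 f1 A2 F2 f2 x v =
    sqrt ((f2 (snd x))\<^sup>2 * (F1 (fst x) (differential (product_atlas A1 A2) A1 fst x v))\<^sup>2 +
          (f1 (fst x))\<^sup>2 * (F2 (snd x) (differential (product_atlas A1 A2) A2 snd x v))\<^sup>2)"
proof -
  define c1 c2 where "c1 = some_chart A1 (fst x)" and "c2 = some_chart A2 (snd x)"
  have c: "c1 \<in> charts_at A1 (fst x)" "c2 \<in> charts_at A2 (snd x)"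
    using some_chart_in_charts_at A1 A2 by (auto simp: c1_def c2_def)
  have zero: "partial_fun c1 f1 i (fst x) * partial_fun c2 f2 j (snd x) = 0" for i j
  proof -
    \<comment> \<open>Symmetry is available only for nonzero vectors; the matrix block in question does not
      depend on them, so any two basis vectors will do.\<close>
    define G where "G = associated_matrix A1 F1 f1 A2 F2 f2 c1 c2 (fst x) (snd x) (axis i 1) (axis j 1)"
    have sym: "transpose G = G"
      using conv c unfolding convolution_finsler_def Let_def G_def by (simp add: axis_eq_0_iff)
    have "transpose G $ Inl i $ Inr j = G $ Inr j $ Inl i" by (simp add: transpose_def)
    then have "G $ Inl i $ Inr j = G $ Inr j $ Inl i" unfolding sym .
    then show ?thesis using pos(1)[of "fst x"] pos(2)[of "snd x"] by (simp add: G_def associated_matrix_def)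
  qed
  have grad: "gradient A1 F1 f1 c1 (fst x) v1 $ i * gradient A2 F2 f2 c2 (snd x) v2 $ j = 0" for i j v1 v2
  proof -
    have "(a * partial_fun c1 f1 k (fst x)) * (b * partial_fun c2 f2 l (snd x)) = 0" for a b k l
      using zero[of k l] by auto
    then show ?thesis
      by (simp only: gradient_def vec_lambda_beta sum_product sum.neutral_const)
  qed
  have "(a * gradient A1 F1 f1 c1 (fst x) v1 $ i) * gradient A2 F2 f2 c2 (snd x) v2 $ j = 0" for a i j v1 v2
    using grad[of v1 i v2 j] by auto
  then show ?thesis
    unfolding convolution_def Let_def c1_def[symmetric] c2_def[symmetric]
    by (simp only: sum.neutral_const mult_zero_right add_0_right)
qed

lemma finsler_metric_zero:
  assumes A: "smooth_atlas A" and F: "finsler_metric A F"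
  shows "F p (\<lambda>_. 0) = 0"
proof -
  have "\<forall>v\<in>tangent_space A p. \<forall>r>0. F p (\<lambda>c. r *\<^sub>R v c) = r * F p v"
    using F by (simp add: finsler_metric_def)
  from this[rule_format, OF tangent_space_zero[OF A], of 2]
  show ?thesis by simp
qed

lemma finsler_metric_nonneg: "finsler_metric A F \<Longrightarrow> v \<in> tangent_space A p \<Longrightarrow> F p v \<ge> 0"
  unfolding finsler_metric_def by blast


theorem theorem3p2:
  fixes A1 :: "('a::{t2_space, second_countable_topology}, 'n::finite) chart set"
    and A2 :: "('b::{t2_space, second_countable_topology}, 'm::finite) chart set"
    and F1 :: "'a \<Rightarrow> ('a, 'n) tangent \<Rightarrow> real" and F2 :: "'b \<Rightarrow> ('b, 'm) tangent \<Rightarrow> real"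
    and f1 :: "'a \<Rightarrow> real" and f2 :: "'b \<Rightarrow> real"
  assumes "smooth_atlas A1" and "smooth_atlas A2"
    and "finsler_metric A1 F1" and "finsler_metric A2 F2"
    and "smooth_fun A1 f1" and "smooth_fun A2 f2"
    and "\<And>x1. f1 x1 > 0" and "\<And>x2. f2 x2 > 0"
    and "convolution_finsler A1 F1 f1 A2 F2 f2"
  shows "riemannian (product_atlas A1 A2) (convolution A1 F1 f1 A2 F2 f2) \<longleftrightarrow>
         riemannian A1 F1 \<and> riemannian A2 F2"
proof -
  let ?A = "product_atlas A1 A2" and ?F = "convolution A1 F1 f1 A2 F2 f2"
  let ?d1 = "differential ?A A1 fst" and ?d2 = "differential ?A A2 snd"
  note A1 = assms(1) and A2 = assms(2)
  note A = smooth_atlas_product[OF A1 A2]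
  note conv = convolution_eq[OF A1 A2 assms(7-9)]
  note D1 = affine_in_charts_imp_differentiable_map[OF A A1 affine_fst]
  note D2 = affine_in_charts_imp_differentiable_map[OF A A2 affine_snd]
  note T1 = differential_in_tangent_space[OF A A1 D1] and T2 = differential_in_tangent_space[OF A A2 D2]
  \<comment> \<open>On vectors tangent to a slice the other factor contributes the value of its metric at the
    zero vector, which is \<open>0\<close>, so the convolution is a positive multiple of one factor.\<close>
  have fwd1: "riemannian A1 F1" if R: "riemannian ?A ?F"
  proof -
    fix q0 :: 'b
    let ?h = "\<lambda>p. (p, q0)"
    let ?dh = "differential A1 ?A ?h"
    note h = affine_slice1[OF A2, of A1 q0]
    note dh = affine_in_charts_imp_differentiable_map[OF A1 A h]
    have fst: "?d1 (p, q0) (?dh p v) = v" if "v \<in> tangent_space A1 p" for p v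
      using differential_comp[OF A1 A A1 dh D1 that] differential_id[OF A1 that]
      by (simp add: comp_def id_def)
    have snd: "?d2 (p, q0) (?dh p v) = (\<lambda>_. 0)" if "v \<in> tangent_space A1 p" for p v
      using differential_comp[OF A1 A A2 dh D2 that] by (simp add: comp_def differential_const)
    have inj: "v = (\<lambda>_. 0)" if "v \<in> tangent_space A1 p" "?dh p v = (\<lambda>_. 0)" for p v
      using fst[OF that(1)] that(2) differential_zero[OF A D1] by simp
    have "?F (p, q0) (?dh p v) = f2 q0 * F1 p v" if v: "v \<in> tangent_space A1 p" for p v
      unfolding conv
      using fst[OF v] snd[OF v] assms(8)[of q0] finsler_metric_nonneg[OF assms(3) v]
      by (simp add: finsler_metric_zero[OF A2 assms(4)] real_sqrt_mult)
    then show ?thesis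
      using assms(8)[of q0]
      by (intro riemannian_scale[OF A1 riemannian_restrict[OF A1 A h inj R], where r = "inverse (f2 q0)"])
         (simp_all add: field_simps)
  qed
  have fwd2: "riemannian A2 F2" if R: "riemannian ?A ?F"
  proof -
    fix p0 :: 'a
    let ?h = "\<lambda>q. (p0, q)"
    let ?dh = "differential A2 ?A ?h"
    note h = affine_slice2[OF A1, of A2 p0]
    note dh = affine_in_charts_imp_differentiable_map[OF A2 A h]
    have snd: "?d2 (p0, q) (?dh q v) = v" if "v \<in> tangent_space A2 q" for q v
      using differential_comp[OF A2 A A2 dh D2 that] differential_id[OF A2 that]
      by (simp add: comp_def id_def)
    have fst: "?d1 (p0, q) (?dh q v) = (\<lambda>_. 0)" if "v \<in> tangent_space A2 q" for q v
      using differential_comp[OF A2 A A1 dh D1 that] by (simp add: comp_def differential_const)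
    have inj: "v = (\<lambda>_. 0)" if "v \<in> tangent_space A2 q" "?dh q v = (\<lambda>_. 0)" for q v
      using snd[OF that(1)] that(2) differential_zero[OF A D2] by simp
    have "?F (p0, q) (?dh q v) = f1 p0 * F2 q v" if v: "v \<in> tangent_space A2 q" for q v
      unfolding conv
      using fst[OF v] snd[OF v] assms(7)[of p0] finsler_metric_nonneg[OF assms(4) v]
      by (simp add: finsler_metric_zero[OF A1 assms(3)] real_sqrt_mult)
    then show ?thesis
      using assms(7)[of p0]
      by (intro riemannian_scale[OF A2 riemannian_restrict[OF A2 A h inj R], where r = "inverse (f1 p0)"])
         (simp_all add: field_simps)
  qed
  have bwd: "riemannian ?A ?F" if R1: "riemannian A1 F1" and R2: "riemannian A2 F2"
  proof -
    obtain g1 where g1: "\<And>p. inner_product_on (tangent_space A1 p) (g1 p)"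
      and s1: "\<And>c k l. c \<in> A1 \<Longrightarrow> smooth_on (coord c ` cdom c) (metric_component A1 g1 c k l)"
      and F1: "\<And>p v. v \<in> tangent_space A1 p \<Longrightarrow> F1 p v = sqrt (g1 p v v)"
      using R1 unfolding riemannian_def by blast
    obtain g2 where g2: "\<And>p. inner_product_on (tangent_space A2 p) (g2 p)"
      and s2: "\<And>c k l. c \<in> A2 \<Longrightarrow> smooth_on (coord c ` cdom c) (metric_component A2 g2 c k l)"
      and F2: "\<And>p v. v \<in> tangent_space A2 p \<Longrightarrow> F2 p v = sqrt (g2 p v v)"
      using R2 unfolding riemannian_def by blast
    \<comment> \<open>The doubly warped product metric.\<close>
    define G where "G x u w = (f2 (snd x))\<^sup>2 * pullback ?A A1 fst g1 x u w +
      (f1 (fst x))\<^sup>2 * pullback ?A A2 snd g2 x u w" for x u w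
    have comp: "metric_component ?A G c i j = (\<lambda>x.
        (f2 \<circ> snd \<circ> coord_inv c) x * (f2 \<circ> snd \<circ> coord_inv c) x *
          metric_component ?A (pullback ?A A1 fst g1) c i j x +
        (f1 \<circ> fst \<circ> coord_inv c) x * (f1 \<circ> fst \<circ> coord_inv c) x *
          metric_component ?A (pullback ?A A2 snd g2) c i j x)" for c i j
      by (simp add: metric_component_def Let_def G_def fun_eq_iff power2_eq_square)
    have nn1: "0 \<le> g1 (fst x) (?d1 x v) (?d1 x v)" and nn2: "0 \<le> g2 (snd x) (?d2 x v) (?d2 x v)"
      if "v \<in> tangent_space ?A x" for x v
      by (intro inner_product_on_nonneg[OF g1 T1[OF that]] inner_product_on_nonneg[OF g2 T2[OF that]])+
    show ?thesis
      unfolding riemannian_def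
    proof (intro exI[of _ G] conjI allI ballI)
      show "inner_product_on (tangent_space ?A x) (G x)" for x
        unfolding inner_product_on_def
      proof (intro conjI ballI allI impI)
        fix u w assume u: "u \<in> tangent_space ?A x" and w: "w \<in> tangent_space ?A x"
        show "G x u w = G x w u"
          using inner_product_onD(1)[OF g1 T1[OF u] T1[OF w]] inner_product_onD(1)[OF g2 T2[OF u] T2[OF w]]
          by (simp add: G_def pullback_def)
        show "G x (\<lambda>c. r *\<^sub>R u c) w = r * G x u w" for r
          using u w by (simp add: G_def pullback_def differential_scale[OF A D1] differential_scale[OF A D2]
              inner_product_onD(3)[OF g1] inner_product_onD(3)[OF g2] T1 T2 algebra_simps)
        show "G x (\<lambda>c. u c + v c) w = G x u w + G x v w" if "v \<in> tangent_space ?A x" for v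
          using u w that by (simp add: G_def pullback_def differential_add[OF A D1] differential_add[OF A D2]
              inner_product_onD(2)[OF g1] inner_product_onD(2)[OF g2] T1 T2 algebra_simps)
      next
        fix u assume u: "u \<in> tangent_space ?A x" and "u \<noteq> (\<lambda>_. 0)"
        then have "?d1 x u \<noteq> (\<lambda>_. 0) \<or> ?d2 x u \<noteq> (\<lambda>_. 0)"
          using product_tangent_eq_zero[OF A1 A2 u] by blast
        then have "0 < g1 (fst x) (?d1 x u) (?d1 x u) \<or> 0 < g2 (snd x) (?d2 x u) (?d2 x u)"
          using inner_product_onD(4)[OF g1 T1[OF u]] inner_product_onD(4)[OF g2 T2[OF u]] by blast
        then show "0 < G x u u"
          using nn1[OF u] nn2[OF u] assms(7)[of "fst x"] assms(8)[of "snd x"]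
          unfolding G_def pullback_def
          by (elim disjE) (simp_all add: add_pos_nonneg add_nonneg_pos)
      qed
      show "smooth_on (coord c ` cdom c) (metric_component ?A G c i j)" if c: "c \<in> ?A" for c i j
        unfolding comp
        using smooth_fun_comp_affine[OF A A1 affine_fst assms(5)] c
          smooth_fun_comp_affine[OF A A2 affine_snd assms(6)]
        by (intro smooth_on_add smooth_on_mult atlas_chart(2)[OF A c]
            smooth_pullback[OF A A1 affine_fst g1 s1 c] smooth_pullback[OF A A2 affine_snd g2 s2 c])
          (auto simp: smooth_fun_def comp_def)
      show "?F x v = sqrt (G x v v)" if "v \<in> tangent_space ?A x" for x v
        unfolding conv F1[OF T1[OF that]] F2[OF T2[OF that]]
        using nn1[OF that] nn2[OF that] by (simp add: G_def pullback_def)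
    qed
  qed
  show ?thesis using fwd1 fwd2 bwd by blast
qed

end
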